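(* Let $A=A_0+A_1e_1+\dots+A_7e_7$ (with $A_0,\dots,A_7$ real $2\times2$ matrices) be a tangent vector to $SL(2,\mathbf{O})$, where $\{e_1,\dots,e_7\}$ is a standard basis for the imaginary octonions. Then the invariant inner product is $$(A,A)=2\Bigl(\sum_{i=1}^7\mathrm{tr}\,A_i^2-\mathrm{tr}\,A_0^2\Bigr).$$ It has signature $(22,9)$.
   Context: Let $S^+,S^-$ be the two real $8$-dimensional half-spin representations of $Spin(8)$, with invariant positive definite inner products $\langle\,,\rangle$, and Clifford multiplication $\mathbf{R}^8\otimes S^\pm\to S^\mp$ satisfying $x\cdot(y\cdot\varphi)+y\cdot(x\cdot\varphi)=-2\langle x,y\rangle\varphi$ and $\langle x\cdot\varphi^-,\varphi^+\rangle=-\langle\varphi^-,x\cdot\varphi^+\rangle$. For $\varphi^\pm\in S^\pm$ define $\varphi^+\cdot\varphi^-=\varphi^-\cdot\varphi^+\in\mathbf{R}^8$ by $\langle x,\varphi^+\cdot\varphi^-\rangle=\langle x\cdot\varphi^-,\varphi^+\rangle$ for all $x\in\mathbf{R}^8$. $\mathbf{T}$ is the real $16$-dimensional space of $S^+$-valued functions $\psi(\mathbf{x})=\mathbf{x}\cdot\varphi^-+\varphi^+$ on $\mathbf{R}^8$ ($\varphi^\pm\in S^\pm$ constant), $\mathbf{T}\cong S^-\oplus S^+$. The group $Spin(9,1)$ acts on $\mathbf{T}$ as the subgroup of $GL(\mathbf{T})$ generated by $(\varphi^-,\varphi^+)\mapsto(\varphi^-,\varphi^++a\cdot\varphi^-)$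 and $(\varphi^-,\varphi^+)\mapsto(\varphi^-+a\cdot\varphi^+,\varphi^+)$, $a\in\mathbf{R}^8$. Elements $\rho=(\psi_1,\psi_2)\in\mathbf{T}\otimes\mathbf{R}^2$, with $\psi_a=\mathbf{x}\cdot\varphi_a^-+\varphi_a^+$, are written as matrices $\rho=\begin{pmatrix}\varphi_1^-&\varphi_1^+\\ \varphi_2^-&\varphi_2^+\end{pmatrix}$, and $$\det\rho=\Vert\varphi_1^-\Vert^2\Vert\varphi_2^+\Vert^2+\Vert\varphi_2^-\Vert^2\Vert\varphi_1^+\Vert^2-2\langle\varphi_1^-\cdot\varphi_1^+,\varphi_2^-\cdot\varphi_2^+\rangle .$$ $GL(2,\mathbf{O})$ denotes the open set $\{\det\rho\ne0\}$ and $SL(2,\mathbf{O})$ the $31$-dimensional submanifold $\{\det\rho=1\}\subset\mathbf{T}\otimes\mathbf{R}^2$. The function $\det$ is invariant under $Spin(9,1)\times SL(2,\mathbf{R})$ ($SL(2,\mathbf{R})$ acting on the $\mathbf{R}^2$ factor), and this group acts transitively on $SL(2,\mathbf{O})$. Invariant inner product: the Hessian (on the vector space $\mathbf{T}\otimes\mathbf{R}^2$) of $\log\det\rho$, restricted to the tangent spaces of $SL(2,\mathbf{O})$. It is $Spin(9,1)\times SL(2,\mathbf{R})$-invariant. Identification of tangent vectors with octonionic matrices: let $\rho_0$ be a point with $\varphi_1^+=0$, $\varphi_2^-=0$ and $\varphi_1^-,\varphi_2^+$ of unit length, and let $\mathbf{e}=\varphi_1^-\cdot\varphi_2^+$, a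 unit vector with $\mathbf{e}\cdot\varphi_1^-=\varphi_2^+$. Identify $S^-$ with the octonions $\mathbf{O}$ isometrically so that $\varphi_1^-$ corresponds to $1\in\mathbf{O}$ (equivariantly for the stabilizer $G_2\subset Spin(8)$ of $\varphi_1^-,\varphi_2^+$, acting on $\mathbf{O}$ by automorphisms), and identify $S^+$ with $S^-\cong\mathbf{O}$ through Clifford multiplication by $\mathbf{e}:S^-\to S^+$, so $\varphi_2^+$ also corresponds to $1$. A tangent vector $(\dot\varphi_a^\pm)$ at $\rho_0$ is then a $2\times2$ octonionic matrix $A=\begin{pmatrix}a&b\\c&d\end{pmatrix}$ with $a=\dot\varphi_1^-$, $b=\dot\varphi_1^+$, $c=\dot\varphi_2^-$, $d=\dot\varphi_2^+$. Being tangent to $SL(2,\mathbf{O})$ means that $a+d$ is imaginary, i.e. $\mathrm{tr}\,A_0=0$. Tangent spaces at other points of $SL(2,\mathbf{O})$ are identified with such matrices by transport with an element of $Spin(9,1)\times SL(2,\mathbf{R})$ taking $\rho_0$ to the given point. *)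

theory Defs
  imports "HOL-Analysis.Analysis"
begin

section \<open>Octonions\<close>

text \<open>
  The octonions by Cayley--Dickson doubling from the complex numbers. As a product type they carry
  the Euclidean inner product, for which the conjugate of \<open>x\<close> times \<open>x\<close> is the squared norm.
\<close>

type_synonym quaternion = "complex \<times> complex"
type_synonym octonion = "quaternion \<times> quaternion"

definition qmult :: "quaternion \<Rightarrow> quaternion \<Rightarrow> quaternion" where
  "qmult = (\<lambda>(a, b) (c, d). (a * c - cnj d * b, d * a + b * cnj c))"

definition qconj :: "quaternion \<Rightarrow> quaternion" where
  "qconj = (\<lambda>(a, b). (cnj a, - b))"

definition omult :: "octonion \<Rightarrow> octonion \<Rightarrow> octonion" (infixl "\<star>" 70) where
  "omult = (\<lambda>(a, b) (c, d). (qmult a c - qmult (qconj d) b, qmult d a + qmult b (qconj c)))"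

definition oconj :: "octonion \<Rightarrow> octonion" where
  "oconj = (\<lambda>(a, b). (qconj a, - b))"

definition oone :: octonion where
  "oone = ((1, 0), (0, 0))"

definition octonion_automorphism :: "(octonion \<Rightarrow> octonion) \<Rightarrow> bool" where
  "octonion_automorphism f \<longleftrightarrow> linear f \<and> bij f \<and> (\<forall>x y. f (x \<star> y) = f x \<star> f y)"

text \<open>
  A standard basis \<open>e 1, \<dots>, e 7\<close> of the imaginary octonions: orthonormal, and the product of two
  distinct members is again a member up to sign. This covers every labelling and sign convention
  for the multiplication table (the Fano plane). Only the indices from 1 to 7 matter.
\<close>

definition standard_imag_basis :: "(nat \<Rightarrow> octonion) \<Rightarrow> bool" where
  "standard_imag_basis e \<longleftrightarrow>
     (\<forall>i\<in>{1..7}. e i \<bullet> oone = 0) \<and>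
     (\<forall>i\<in>{1..7}. \<forall>j\<in>{1..7}. e i \<bullet> e j = (if i = j then 1 else 0)) \<and>
     (\<forall>i\<in>{1..7}. \<forall>j\<in>{1..7}. i \<noteq> j \<longrightarrow> (\<exists>k\<in>{1..7}. e i \<star> e j = e k \<or> e i \<star> e j = - e k))"

text \<open>The octonionic matrix \<open>A 0 + A 1 e\<^sub>1 + \<dots> + A 7 e\<^sub>7\<close>.\<close>

definition octonion_matrix :: "(nat \<Rightarrow> octonion) \<Rightarrow> (nat \<Rightarrow> real^2^2) \<Rightarrow> octonion^2^2" where
  "octonion_matrix e A =
     (\<chi> r s. (A 0 $ r $ s) *\<^sub>R oone + (\<Sum>i\<in>{1..7}. (A i $ r $ s) *\<^sub>R e i))"


section \<open>Half-spin representations of Spin(8)\<close>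

text \<open>
  \<open>cm x\<close> and \<open>cp x\<close> are Clifford multiplication by \<open>x\<close> on \<open>S\<^sup>-\<close> and on \<open>S\<^sup>+\<close>, modelled on the
  types \<open>'m\<close> and \<open>'p\<close>. The axioms determine the half-spin representations: the Clifford algebra
  of the Euclidean space of dimension 8 is a full algebra of real matrices of size 16, so up to
  isomorphism it has just two graded modules of dimension \<open>8 + 8\<close>, exchanged by a reversal of
  orientation of the space, and the inner product is unique up to one common scale.
\<close>

definition half_spin_clifford ::
  "(real^8 \<Rightarrow> 'm::euclidean_space \<Rightarrow> 'p::euclidean_space) \<Rightarrow> (real^8 \<Rightarrow> 'p \<Rightarrow> 'm) \<Rightarrow> bool" where
  "half_spin_clifford cm cp \<longleftrightarrow>
     DIM('m) = 8 \<and> DIM('p) = 8 \<and>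
     bilinear cm \<and> bilinear cp \<and>
     (\<forall>x y \<phi>. cp x (cm y \<phi>) + cp y (cm x \<phi>) = (- 2 * (x \<bullet> y)) *\<^sub>R \<phi>) \<and>
     (\<forall>x y \<phi>. cm x (cp y \<phi>) + cm y (cp x \<phi>) = (- 2 * (x \<bullet> y)) *\<^sub>R \<phi>) \<and>
     (\<forall>x \<phi>m \<phi>p. cm x \<phi>m \<bullet> \<phi>p = - (\<phi>m \<bullet> cp x \<phi>p))"

text \<open>
  Spin(8) as the group of products of an even number of unit vectors in the Clifford algebra,
  through its (faithful) action on the pair \<open>S\<^sup>-\<close>, \<open>S\<^sup>+\<close>. The inverse of \<open>u v\<close> is \<open>v u\<close>, so closure
  under composition suffices.
\<close>

inductive_set spin8 ::
  "(real^8 \<Rightarrow> 'm::euclidean_space \<Rightarrow> 'p::euclidean_space) \<Rightarrow> (real^8 \<Rightarrow> 'p \<Rightarrow> 'm) \<Rightarrow>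
   (('m \<Rightarrow> 'm) \<times> ('p \<Rightarrow> 'p)) set"
  for cm cp where
  one: "(id, id) \<in> spin8 cm cp"
| step: "(gm, gp) \<in> spin8 cm cp \<Longrightarrow> norm u = 1 \<Longrightarrow> norm v = 1 \<Longrightarrow>
    ((\<lambda>\<phi>. cp u (cm v (gm \<phi>))), (\<lambda>\<phi>. cm u (cp v (gp \<phi>)))) \<in> spin8 cm cp"

definition spin_prod ::
  "(real^8 \<Rightarrow> 'm::euclidean_space \<Rightarrow> 'p::euclidean_space) \<Rightarrow> 'm \<Rightarrow> 'p \<Rightarrow> real^8" where
  "spin_prod cm \<phi>m \<phi>p = (THE v. \<forall>x. x \<bullet> v = cm x \<phi>m \<bullet> \<phi>p)"


section \<open>The group SL(2,O)\<close>

text \<open>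
  The field \<open>\<lambda>x. cm x \<phi>m + \<phi>p\<close> in \<open>\<^bold>T\<close> is represented by the pair \<open>(\<phi>m, \<phi>p)\<close>, and an element of
  the tensor product of \<open>\<^bold>T\<close> with the plane by a pair of such pairs, the rows of the matrix.
\<close>

type_synonym ('m, 'p) spin_matrix = "('m \<times> 'p) \<times> ('m \<times> 'p)"

definition spin_det ::
  "(real^8 \<Rightarrow> 'm::euclidean_space \<Rightarrow> 'p::euclidean_space) \<Rightarrow> ('m, 'p) spin_matrix \<Rightarrow> real" where
  "spin_det cm = (\<lambda>((m1, p1), (m2, p2)).
     (norm m1)\<^sup>2 * (norm p2)\<^sup>2 + (norm m2)\<^sup>2 * (norm p1)\<^sup>2
       - 2 * (spin_prod cm m1 p1 \<bullet> spin_prod cm m2 p2))"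

definition SL2O ::
  "(real^8 \<Rightarrow> 'm::euclidean_space \<Rightarrow> 'p::euclidean_space) \<Rightarrow> ('m, 'p) spin_matrix set" where
  "SL2O cm = {\<rho>. spin_det cm \<rho> = 1}"

text \<open>
  The generators are closed under inverses (replace \<open>a\<close> by \<open>- a\<close>), so closure under composition
  gives the generated subgroup.
\<close>

inductive_set spin91 ::
  "(real^8 \<Rightarrow> 'm::euclidean_space \<Rightarrow> 'p::euclidean_space) \<Rightarrow> (real^8 \<Rightarrow> 'p \<Rightarrow> 'm) \<Rightarrow>
   ('m \<times> 'p \<Rightarrow> 'm \<times> 'p) set"
  for cm cp where
  one: "id \<in> spin91 cm cp"
| lower: "g \<in> spin91 cm cp \<Longrightarrow> (\<lambda>(\<phi>m, \<phi>p). (\<phi>m, \<phi>p + cm a \<phi>m)) \<circ> g \<in> spin91 cm cp"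
| upper: "g \<in> spin91 cm cp \<Longrightarrow> (\<lambda>(\<phi>m, \<phi>p). (\<phi>m + cp a \<phi>p, \<phi>p)) \<circ> g \<in> spin91 cm cp"

definition group_act ::
  "('m \<times> 'p \<Rightarrow> 'm \<times> 'p) \<Rightarrow> real^2^2 \<Rightarrow>
   ('m::euclidean_space, 'p::euclidean_space) spin_matrix \<Rightarrow> ('m, 'p) spin_matrix" where
  "group_act g M = (\<lambda>(\<psi>1, \<psi>2).
     (M $ 1 $ 1 *\<^sub>R g \<psi>1 + M $ 1 $ 2 *\<^sub>R g \<psi>2, M $ 2 $ 1 *\<^sub>R g \<psi>1 + M $ 2 $ 2 *\<^sub>R g \<psi>2))"


section \<open>The invariant inner product\<close>

text \<open>
  Velocities of curves in \<open>S\<close>, required to be differentiable only at time 0; for an embedded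
  submanifold this is the tangent space.
\<close>

definition tangent_space :: "'a::real_normed_vector set \<Rightarrow> 'a \<Rightarrow> 'a set" where
  "tangent_space S x =
     {v. \<exists>\<gamma>. (\<forall>t. \<gamma> t \<in> S) \<and> \<gamma> 0 = x \<and> (\<gamma> has_vector_derivative v) (at (0::real))}"

definition hessian :: "('a::real_normed_vector \<Rightarrow> real) \<Rightarrow> 'a \<Rightarrow> 'a \<Rightarrow> 'a \<Rightarrow> real" where
  "hessian f x u v = frechet_derivative (\<lambda>y. frechet_derivative f (at y) v) (at x) u"

definition invariant_inner ::
  "(real^8 \<Rightarrow> 'm::euclidean_space \<Rightarrow> 'p::euclidean_space) \<Rightarrow> ('m, 'p) spin_matrix \<Rightarrow>
   ('m, 'p) spin_matrix \<Rightarrow> ('m, 'p) spin_matrix \<Rightarrow> real" where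
  "invariant_inner cm \<rho> = hessian (\<lambda>\<sigma>. ln (spin_det cm \<sigma>)) \<rho>"

text \<open>
  Signature \<open>(p, q)\<close> of a symmetric bilinear form \<open>B\<close> on a subspace \<open>V\<close>: \<open>V\<close> is the orthogonal sum
  of a positive definite subspace of dimension \<open>p\<close> and a negative definite one of dimension \<open>q\<close>
  (in particular \<open>B\<close> is nondegenerate on \<open>V\<close>).
\<close>

definition has_signature ::
  "'a::euclidean_space set \<Rightarrow> ('a \<Rightarrow> 'a \<Rightarrow> real) \<Rightarrow> nat \<Rightarrow> nat \<Rightarrow> bool" where
  "has_signature V B p q \<longleftrightarrow>
     (\<exists>P N. subspace P \<and> subspace N \<and> V = {u + w |u w. u \<in> P \<and> w \<in> N} \<and>
        dim P = p \<and> dim N = q \<and>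
        (\<forall>u\<in>P. u \<noteq> 0 \<longrightarrow> B u u > 0) \<and> (\<forall>w\<in>N. w \<noteq> 0 \<longrightarrow> B w w < 0) \<and>
        (\<forall>u\<in>P. \<forall>w\<in>N. B u w = 0 \<and> B w u = 0))"


section \<open>Tangent vectors as octonionic matrices\<close>

text \<open>
  \<open>\<iota>\<close> identifies \<open>S\<^sup>-\<close> with the octonions, for the base point with diagonal \<open>m1\<close>, \<open>p2\<close> and zero
  off-diagonal entries. The stabilizer of \<open>m1\<close> and \<open>p2\<close> in Spin(8) is the group \<open>G\<^sub>2\<close>.
\<close>

definition octonion_identification ::
  "(real^8 \<Rightarrow> 'm::euclidean_space \<Rightarrow> 'p::euclidean_space) \<Rightarrow> (real^8 \<Rightarrow> 'p \<Rightarrow> 'm) \<Rightarrow>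
   'm \<Rightarrow> 'p \<Rightarrow> ('m \<Rightarrow> octonion) \<Rightarrow> bool" where
  "octonion_identification cm cp m1 p2 \<iota> \<longleftrightarrow>
     linear \<iota> \<and> bij \<iota> \<and> (\<forall>\<phi>. norm (\<iota> \<phi>) = norm \<phi>) \<and> \<iota> m1 = oone \<and>
     (\<forall>(gm, gp) \<in> spin8 cm cp. gm m1 = m1 \<and> gp p2 = p2 \<longrightarrow>
        (\<exists>\<alpha>. octonion_automorphism \<alpha> \<and> (\<forall>\<phi>. \<iota> (gm \<phi>) = \<alpha> (\<iota> \<phi>))))"

text \<open>\<open>S\<^sup>+\<close> is identified with \<open>S\<^sup>-\<close> by Clifford multiplication by \<open>spin_prod cm m1 p2\<close>.\<close>

definition base_matrix ::
  "(real^8 \<Rightarrow> 'm::euclidean_space \<Rightarrow> 'p::euclidean_space) \<Rightarrow> 'm \<Rightarrow> 'p \<Rightarrow> ('m \<Rightarrow> octonion) \<Rightarrow>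
   ('m, 'p) spin_matrix \<Rightarrow> octonion^2^2" where
  "base_matrix cm m1 p2 \<iota> = (\<lambda>((a, b), (c, d)).
     let j = \<iota> \<circ> inv (cm (spin_prod cm m1 p2))
     in vector [vector [\<iota> a, j b], vector [\<iota> c, j d]])"

text \<open>
  \<open>X\<close>, a vector at \<open>\<rho>\<close>, corresponds to the octonionic matrix \<open>Q\<close> for some choice of the base point,
  of the identification \<open>\<iota>\<close> and of the group element taking the base point to \<open>\<rho>\<close>. The group acts
  linearly, so it acts on tangent vectors as it does on points.
\<close>

definition represents_tangent ::
  "(real^8 \<Rightarrow> 'm::euclidean_space \<Rightarrow> 'p::euclidean_space) \<Rightarrow> (real^8 \<Rightarrow> 'p \<Rightarrow> 'm) \<Rightarrow>
   ('m, 'p) spin_matrix \<Rightarrow> ('m, 'p) spin_matrix \<Rightarrow> octonion^2^2 \<Rightarrow> bool" where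
  "represents_tangent cm cp \<rho> X Q \<longleftrightarrow>
     (\<exists>m1 p2 \<iota> g M X0. norm m1 = 1 \<and> norm p2 = 1 \<and> octonion_identification cm cp m1 p2 \<iota> \<and>
        g \<in> spin91 cm cp \<and> det M = 1 \<and> group_act g M ((m1, 0), (0, p2)) = \<rho> \<and>
        group_act g M X0 = X \<and> base_matrix cm m1 p2 \<iota> X0 = Q)"


section \<open>The definitions are inhabited\<close>

lemma octonion_cases:
  obtains a b c d p q r s where "x = ((Complex a b, Complex c d), (Complex p q, Complex r s))"
  by (metis complex_surj prod.collapse)

lemmas octonion_simps = omult_def oconj_def oone_def qmult_def qconj_def inner_prod_def
  inner_complex_def zero_prod_def complex_eq_iff

lemma inner_omult: "(x \<star> y) \<bullet> z = y \<bullet> (oconj x \<star> z)"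
  by (rule octonion_cases[of x], rule octonion_cases[of y], rule octonion_cases[of z])
    (simp add: octonion_simps algebra_simps)

lemma oconj_omult: "oconj x \<star> (x \<star> z) = (x \<bullet> x) *\<^sub>R z"
  by (rule octonion_cases[of x], rule octonion_cases[of z]) (simp add: octonion_simps algebra_simps)

lemma omult_oconj: "x \<star> (oconj x \<star> z) = (x \<bullet> x) *\<^sub>R z"
  by (rule octonion_cases[of x], rule octonion_cases[of z]) (simp add: octonion_simps algebra_simps)

lemma norm_omult: "norm (x \<star> y) = norm x * norm y"
proof -
  have "(x \<star> y) \<bullet> (x \<star> y) = (x \<bullet> x) * (y \<bullet> y)"
    by (simp add: inner_omult oconj_omult)
  then show ?thesis
    by (simp add: norm_eq_sqrt_inner real_sqrt_mult)
qed

lemma bilinear_omult: "bilinear (\<star>)"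
  unfolding bilinear_def
  by (intro conjI allI linearI; clarsimp simp: omult_def qmult_def qconj_def complex_eq_iff;
      simp add: algebra_simps)

lemma linear_oconj: "linear oconj"
  by (rule linearI; clarsimp simp: oconj_def qconj_def complex_eq_iff)

lemma ex_standard_imag_basis: "\<exists>e. standard_imag_basis e"
proof
  let ?b = "[((\<i>, 0), (0, 0)), ((0, 1), (0, 0)), ((0, \<i>), (0, 0)), ((0, 0), (1, 0)),
    ((0, 0), (\<i>, 0)), ((0, 0), (0, 1)), ((0, 0), (0, \<i>))] :: octonion list"
  have I: "{1..7} = {1, 2, 3, 4, 5, 6, 7 :: nat}" by auto
  show "standard_imag_basis (\<lambda>i. ?b ! (i - 1))"
    unfolding standard_imag_basis_def I by (simp add: octonion_simps)
qed

lemma spin8_properties: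
  assumes H: "half_spin_clifford cm cp" and "(gm, gp) \<in> spin8 cm cp"
  shows "linear gm \<and> (\<forall>\<phi>. norm (gm \<phi>) = norm \<phi>) \<and>
    (\<exists>h. \<forall>x \<phi>. gp (cm x \<phi>) = cm (h x) (gm \<phi>))"
  using assms(2)
proof (induction rule: spin8.induct)
  case one
  show ?case by (auto intro: linear_ident exI[of _ id] simp: id_def)
next
  case (step gm gp u v)
  have bil: "bilinear cm" "bilinear cp"
    and cl: "\<And>x y \<phi>. cp x (cm y \<phi>) + cp y (cm x \<phi>) = (- 2 * (x \<bullet> y)) *\<^sub>R \<phi>"
            "\<And>x y \<phi>. cm x (cp y \<phi>) + cm y (cp x \<phi>) = (- 2 * (x \<bullet> y)) *\<^sub>R \<phi>"
    and skew: "\<And>x a b. cm x a \<bullet> b = - (a \<bullet> cp x b)"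
    using H unfolding half_spin_clifford_def by auto
  define s where "s w x = (2 * (w \<bullet> x)) *\<^sub>R w - x" for w x :: "real^8"
  have sq: "cp w (cm w \<phi>) = - \<phi>" "cm w (cp w \<psi>) = - \<psi>" if "norm w = 1" for w \<phi> \<psi>
    using cl(1)[of w w \<phi>] cl(2)[of w w \<psi>] that
    by (simp_all add: dot_square_norm flip: scaleR_2) (simp_all add: scaleR_minus_left flip: scaleR_minus_right)
  have nm: "norm (cm w \<phi>) = norm \<phi>" "norm (cp w \<psi>) = norm \<psi>" if "norm w = 1" for w \<phi> \<psi>
    using skew[of w \<phi> "cm w \<phi>"] skew[of w "cp w \<psi>" \<psi>] sq[OF that]
    by (simp_all add: norm_eq_sqrt_inner)
  have tw: "cp w (cm x \<phi>) = cp (s w x) (cm w \<phi>)" "cm w (cp x \<psi>) = cm (s w x) (cp w \<psi>)"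
    if "norm w = 1" for w x \<phi> \<psi>
    using cl(1)[of w x \<phi>] cl(2)[of w x \<psi>] sq[OF that]
    by (simp_all add: s_def bilinear_lsub[OF bil(1)] bilinear_lsub[OF bil(2)]
        bilinear_lmul[OF bil(1)] bilinear_lmul[OF bil(2)] eq_diff_eq)
  obtain h where h: "\<And>x \<phi>. gp (cm x \<phi>) = cm (h x) (gm \<phi>)"
    using step.IH by blast
  have "cm u (cp v (gp (cm x \<phi>))) = cm (s u (s v (h x))) (cp u (cm v (gm \<phi>)))" for x \<phi>
    using step.hyps by (simp add: h tw)
  moreover have "linear (cp u)" "linear (cm v)"
    using bil by (auto simp: bilinear_def)
  then have "linear (\<lambda>\<phi>. cp u (cm v (gm \<phi>)))"
    using step.IH linear_compose[of gm "\<lambda>\<phi>. cp u (cm v \<phi>)"] linear_compose[of "cm v" "cp u"]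
    by (simp add: o_def)
  ultimately show ?case
    using step.hyps step.IH nm by auto
qed

lemma ex_octonion_identification:
  "\<exists>(cm :: real^8 \<Rightarrow> octonion \<Rightarrow> octonion) cp m1 p2 \<iota>. half_spin_clifford cm cp \<and>
     norm m1 = 1 \<and> norm p2 = 1 \<and> octonion_identification cm cp m1 p2 \<iota>"
proof -
  have "dim (UNIV :: (real^8) set) = dim (UNIV :: octonion set)"
    by simp
  then obtain T :: "real^8 \<Rightarrow> octonion" and T' where T: "linear T" "\<And>x. norm (T x) = norm x"
    and T': "\<And>y. T (T' y) = y"
    using isometries_subspaces[of "UNIV :: (real^8) set" "UNIV :: octonion set"]
    by (metis UNIV_I subspace_UNIV)
  have inner_T: "T x \<bullet> T y = x \<bullet> y" for x y
    by (simp add: dot_norm T flip: linear_add[OF T(1)])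
  note add = bilinear_ladd[OF bilinear_omult] linear_add[OF T(1)] linear_add[OF linear_oconj]
  have polar1: "oconj x \<star> (y \<star> z) + oconj y \<star> (x \<star> z) = (2 * (x \<bullet> y)) *\<^sub>R z" for x y z
    using oconj_omult[of "x + y" z]
    by (simp add: add bilinear_radd[OF bilinear_omult] oconj_omult inner_commute algebra_simps
        scaleR_2)
  have polar2: "x \<star> (oconj y \<star> z) + y \<star> (oconj x \<star> z) = (2 * (x \<bullet> y)) *\<^sub>R z" for x y z
    using omult_oconj[of "x + y" z]
    by (simp add: add bilinear_radd[OF bilinear_omult] omult_oconj inner_commute algebra_simps
        scaleR_2)
  define cm where "cm x \<phi> = T x \<star> \<phi>" for x \<phi>
  define cp where "cp x \<phi> = - (oconj (T x) \<star> \<phi>)" for x \<phi>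
  have "bilinear cm" "bilinear cp"
    unfolding bilinear_def cm_def cp_def
    by (intro conjI allI linearI;
        simp del: split_paired_All add: add bilinear_radd[OF bilinear_omult]
          bilinear_lmul[OF bilinear_omult] bilinear_rmul[OF bilinear_omult] linear_scale[OF T(1)]
          linear_scale[OF linear_oconj])+
  moreover have "cp x (cm y \<phi>) + cp y (cm x \<phi>) = (- 2 * (x \<bullet> y)) *\<^sub>R \<phi>" for x y \<phi>
    using polar1[of "T x" "T y" \<phi>] by (simp add: cm_def cp_def inner_T eq_neg_iff_add_eq_0 algebra_simps)
  moreover have "cm x (cp y \<phi>) + cm y (cp x \<phi>) = (- 2 * (x \<bullet> y)) *\<^sub>R \<phi>" for x y \<phi>
    using polar2[of "T x" "T y" \<phi>]
    by (simp add: cm_def cp_def inner_T bilinear_rneg[OF bilinear_omult] eq_neg_iff_add_eq_0 algebra_simps)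
  moreover have "cm x \<phi>m \<bullet> \<phi>p = - (\<phi>m \<bullet> cp x \<phi>p)" for x \<phi>m \<phi>p
    by (simp add: cm_def cp_def inner_omult)
  ultimately have H: "half_spin_clifford cm cp"
    unfolding half_spin_clifford_def by simp
  have one: "oone \<star> x = x" "x \<star> oone = x" for x
    by (rule octonion_cases[of x]; simp add: octonion_simps)+
  have "octonion_automorphism gm" if g: "(gm, gp) \<in> spin8 cm cp" "gm oone = oone" "gp oone = oone"
    for gm gp
  proof -
    obtain h where lin: "linear gm" and iso: "\<And>\<phi>. norm (gm \<phi>) = norm \<phi>"
      and h: "\<And>x \<phi>. gp (T x \<star> \<phi>) = T (h x) \<star> gm \<phi>"
      using spin8_properties[OF H g(1)] unfolding cm_def by blast
    have 1: "gp (x \<star> y) = gp x \<star> gm y" for x y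
      using h[of "T' x" y] h[of "T' x" oone] g by (simp add: T' one)
    then have "gp = gm"
      using 1[of oone] g by (auto simp: one)
    moreover have "inj gm"
      using iso lin by (metis linear_injective_0 norm_eq_zero)
    ultimately show ?thesis
      using 1 lin unfolding octonion_automorphism_def bij_def
      by (simp add: linear_injective_imp_surjective)
  qed
  then have "octonion_identification cm cp oone oone id"
    unfolding octonion_identification_def by (auto simp: linear_id)
  moreover have "norm oone = 1"
    by (simp add: oone_def norm_Pair)
  ultimately show ?thesis
    using H by blast
qed

end

theory Submission
  imports Defs
begin

text \<open>
  On the level set where the determinant \<open>D\<close> is 1, the Hessian of its logarithm is
  \<open>D''(X, Y) - D'(X) D'(Y)\<close>, and its tangent space is the kernel of \<open>D'\<close>. A linear map that
  preserves \<open>D\<close> carries both to the image point, so everything can be computed at one convenient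
  point of each orbit (\<open>derivative_symmetry\<close>).

  The determinant is invariant because Clifford multiplication is conformal: for fixed nonzero
  \<open>a\<close> in \<open>S\<^sup>-\<close> the map from \<open>x\<close> to \<open>x \<cdot> a\<close> is a similarity of the Euclidean space onto \<open>S\<^sup>+\<close>,
  bijective because both have dimension 8. Its polarized form \<open>S_exchange\<close> gives the invariance
  under \<open>SL(2, \<real>)\<close>. The same bijectivity makes the group transitive: one shear clears an
  off-diagonal entry, a second one clears the other, and a diagonal matrix normalizes the lengths
  (\<open>transitive_on_SL2O\<close>).

  At a diagonal point with unit entries \<open>u\<close>, \<open>v\<close>, write the off-diagonal entries of a tangent vector
  as \<open>y \<cdot> u\<close> and \<open>w \<cdot> v\<close>. The form is then
  \<open>2 |a|\<^sup>2 + 2 |d|\<^sup>2 - 8 \<langle>u, a\<rangle>\<^sup>2 + 4 \<langle>y, w\<rangle>\<close>, subject to \<open>\<langle>u, a\<rangle> + \<langle>v, d\<rangle> = 0\<close>. The parts of \<open>a\<close>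
  and \<open>d\<close> orthogonal to \<open>u\<close> and \<open>v\<close> contribute \<open>7 + 7\<close> positive directions, the remaining diagonal
  direction is negative, and the hyperbolic form \<open>\<langle>y, w\<rangle>\<close> adds 8 of each sign: \<open>(22, 9)\<close>.

  For the octonionic formula, the off-diagonal entry of \<open>S\<^sup>+\<close> is instead moved to \<open>S\<^sup>-\<close> by the unit
  vector that takes \<open>u\<close> to \<open>v\<close>. The exchange identity turns \<open>\<langle>y, w\<rangle>\<close> into \<open>\<langle>b, c\<rangle>\<close> with the sign of
  the component along \<open>u\<close> reversed, which is minus the real part of the octonion product \<open>b c\<close>.
  Only inner products remain, and the identification with the octonions preserves these.
\<close>

section \<open>Level sets and logarithmic Hessians\<close>

lemma hessian_ln:
  fixes D :: "'a::real_normed_vector \<Rightarrow> real"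
  assumes D1: "\<And>y. (D has_derivative D1 y) (at y)"
    and D2: "((\<lambda>y. D1 y v) has_derivative (\<lambda>u. D2 u)) (at x)"
    and pos: "D x > 0"
  shows "hessian (\<lambda>y. ln (D y)) x u v = D2 u / D x - D1 x u * D1 x v / (D x)\<^sup>2"
proof -
  have cont: "continuous_on UNIV D"
    using D1 by (meson continuous_at_imp_continuous_on has_derivative_continuous)
  define U where "U = {y. D y > 0}"
  have U: "open U" "x \<in> U"
    using open_Collect_less[OF continuous_on_const cont] pos by (auto simp: U_def)
  have ln1: "frechet_derivative (\<lambda>y. ln (D y)) (at y) v = D1 y v / D y" if "y \<in> U" for y
  proof -
    have "((\<lambda>y. ln (D y)) has_derivative (\<lambda>h. D1 y h / D y)) (at y)"
      using that by (auto simp: U_def divide_inverse intro!: derivative_eq_intros D1)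
    from fun_cong[OF frechet_derivative_at[OF this], of v] show ?thesis by simp
  qed
  have "((\<lambda>y. D1 y v / D y) has_derivative (\<lambda>h. D2 h / D x - D1 x h * D1 x v / (D x)\<^sup>2)) (at x)"
    by (rule has_derivative_eq_rhs[OF has_derivative_divide'[OF D2 D1]])
      (use pos in \<open>simp_all add: field_simps power2_eq_square\<close>)
  then have "((\<lambda>y. frechet_derivative (\<lambda>y. ln (D y)) (at y) v) has_derivative
      (\<lambda>h. D2 h / D x - D1 x h * D1 x v / (D x)\<^sup>2)) (at x)"
    by (rule has_derivative_transform_within_open[OF _ U]) (simp add: ln1)
  from fun_cong[OF frechet_derivative_at[OF this], of u] show ?thesis
    by (simp add: hessian_def)
qed

text \<open>
  Homogeneity replaces the implicit function theorem: moving along a straight line in a direction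
  \<open>v\<close> of the kernel of the derivative and rescaling back to the level set gives a curve, and the
  scale factor is stationary at time 0, so the velocity is still \<open>v\<close>.
\<close>

lemma tangent_space_homogeneous_level:
  fixes D :: "'a::real_normed_vector \<Rightarrow> real"
  assumes D1: "(D has_derivative D1) (at x)"
    and hom: "\<And>t y. D (t *\<^sub>R y) = t ^ n * D y" and n: "n > 0" and Dx: "D x = 1"
  shows "tangent_space {y. D y = 1} x = {v. D1 v = 0}"
proof (intro set_eqI iffI)
  fix v assume "v \<in> tangent_space {y. D y = 1} x"
  then obtain \<gamma> where \<gamma>: "\<And>t. D (\<gamma> t) = 1" "\<gamma> 0 = x" "(\<gamma> has_vector_derivative v) (at 0)"
    unfolding tangent_space_def by auto
  have "((\<lambda>t. D (\<gamma> t)) has_derivative (\<lambda>h. D1 (h *\<^sub>R v))) (at 0)"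
    by (rule has_derivative_compose[OF \<gamma>(3)[unfolded has_vector_derivative_def]])
      (simp add: \<gamma>(2) D1)
  moreover have "((\<lambda>t. D (\<gamma> t)) has_derivative (\<lambda>h. 0)) (at 0)"
    by (simp add: \<gamma>(1))
  ultimately have "(\<lambda>h. D1 (h *\<^sub>R v)) = (\<lambda>h. 0)"
    by (rule has_derivative_unique)
  from fun_cong[OF this, of 1] show "v \<in> {v. D1 v = 0}" by simp
next
  fix v assume "v \<in> {v. D1 v = 0}"
  then have v: "D1 v = 0" by simp
  have lin: "linear D1" using D1 by (rule has_derivative_linear)
  define l where "l t = x + t *\<^sub>R v" for t
  define c where "c t = D (l t) powr (- 1 / n)" for t
  \<comment> \<open>The line may leave the region where \<open>D\<close> is positive; the curve is constant there.\<close>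
  define \<gamma> where "\<gamma> t = (if D (l t) > 0 then c t *\<^sub>R l t else x)" for t
  have l: "(l has_derivative (\<lambda>h. h *\<^sub>R v)) (at 0)"
    unfolding l_def by (auto intro!: derivative_eq_intros)
  have l0: "l 0 = x" by (simp add: l_def)
  have Dl: "((\<lambda>t. D (l t)) has_derivative (\<lambda>h. D1 (h *\<^sub>R v))) (at 0)"
    by (rule has_derivative_compose[OF l]) (simp add: l0 D1)
  then have Dl': "((\<lambda>t. D (l t)) has_real_derivative 0) (at 0)"
    by (simp add: has_field_derivative_def linear_scale[OF lin] v lambda_zero)
  have pos: "eventually (\<lambda>t. D (l t) > 0) (at 0)"
    using has_derivative_continuous[OF Dl] Dx
    by (intro order_tendstoD(1)[of _ 1]) (auto simp: continuous_at l0)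
  have c: "(c has_real_derivative 0) (at 0)"
    unfolding c_def by (auto intro!: derivative_eq_intros Dl' simp: l0 Dx)
  have "((\<lambda>t. c t *\<^sub>R l t) has_vector_derivative c 0 *\<^sub>R v + 0 *\<^sub>R l 0) (at 0)"
    using has_vector_derivative_scaleR[OF c] l by (simp add: has_vector_derivative_def)
  then have "((\<lambda>t. c t *\<^sub>R l t) has_vector_derivative v) (at 0)"
    by (simp add: c_def l0 Dx)
  then have "(\<gamma> has_vector_derivative v) (at 0)"
    unfolding has_vector_derivative_def
    by (rule has_derivative_transform_eventually)
      (use pos in \<open>auto simp: \<gamma>_def c_def l0 Dx elim: eventually_mono\<close>)
  moreover have "D (\<gamma> t) = 1" for t
  proof (cases "D (l t) > 0")
    case True
    then have "c t ^ n = D (l t) powr (n * (- 1 / n))"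
      unfolding c_def by (intro powr_power) simp
    also have "\<dots> = inverse (D (l t))"
      using True n by (simp add: powr_minus)
    finally have "c t ^ n = inverse (D (l t))" .
    with True show ?thesis by (simp add: \<gamma>_def hom)
  qed (simp add: \<gamma>_def Dx)
  moreover have "\<gamma> 0 = x" by (simp add: \<gamma>_def c_def l0 Dx)
  ultimately show "v \<in> tangent_space {y. D y = 1} x"
    unfolding tangent_space_def mem_Collect_eq by (intro exI[of _ \<gamma>]) simp
qed

lemma has_signature_image:
  assumes sig: "has_signature V B p q" and G: "linear G" "inj G"
    and B: "\<And>u v. B' (G u) (G v) = B u v"
  shows "has_signature (G ` V) B' p q"
proof -
  obtain P N where PN: "subspace P" "subspace N" "V = {u + w |u w. u \<in> P \<and> w \<in> N}"
      "dim P = p" "dim N = q" "\<And>u. u \<in> P \<Longrightarrow> u \<noteq> 0 \<Longrightarrow> B u u > 0"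
      "\<And>w. w \<in> N \<Longrightarrow> w \<noteq> 0 \<Longrightarrow> B w w < 0" "\<And>u w. u \<in> P \<Longrightarrow> w \<in> N \<Longrightarrow> B u w = 0 \<and> B w u = 0"
    using sig unfolding has_signature_def by auto
  have "G ` V = {u + w |u w. u \<in> G ` P \<and> w \<in> G ` N}"
    unfolding PN(3) by (force simp: linear_add[OF G(1)])
  moreover have "dim (G ` P) = p" "dim (G ` N) = q"
    using dim_image_eq[OF G(1)] G(2) PN(4,5) by (auto intro: inj_on_subset)
  moreover have "u \<noteq> 0" if "G u \<noteq> 0" for u
    using that linear_0[OF G(1)] by auto
  ultimately show ?thesis
    unfolding has_signature_def using PN(1,2,6-8)
    by (intro exI[of _ "G ` P"] exI[of _ "G ` N"] conjI ballI)
      (auto simp: B intro!: linear_subspace_image[OF G(1)])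
qed


section \<open>Half-spin algebra\<close>

locale half_spin =
  fixes cm :: "real^8 \<Rightarrow> 'm::euclidean_space \<Rightarrow> 'p::euclidean_space"
    and cp :: "real^8 \<Rightarrow> 'p \<Rightarrow> 'm"
  assumes clifford: "half_spin_clifford cm cp"
begin

lemma dims: "DIM('m) = 8" "DIM('p) = 8"
  and bilinear_cm: "bilinear cm" and bilinear_cp: "bilinear cp"
  and cp_cm: "cp x (cm y a) + cp y (cm x a) = (- 2 * (x \<bullet> y)) *\<^sub>R a"
  and cm_cp: "cm x (cp y b) + cm y (cp x b) = (- 2 * (x \<bullet> y)) *\<^sub>R b"
  and skew: "cm x a \<bullet> b = - (a \<bullet> cp x b)"
  using clifford unfolding half_spin_clifford_def by auto

lemma linear_cm: "linear (\<lambda>x. cm x a)" "linear (cm x)"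
  and linear_cp: "linear (\<lambda>x. cp x b)" "linear (cp x)"
  using bilinear_cm bilinear_cp by (auto simp: bilinear_def)

lemmas cm_simps = linear_cm[THEN linear_add] linear_cm[THEN linear_diff]
  linear_cm[THEN linear_scale] linear_cm[THEN linear_0] linear_cm[THEN linear_neg]
lemmas cp_simps = linear_cp[THEN linear_add] linear_cp[THEN linear_diff]
  linear_cp[THEN linear_scale] linear_cp[THEN linear_0] linear_cp[THEN linear_neg]

text \<open>
  Skewness turns the left side into \<open>- (a \<bullet> cp x (cm y a))\<close>. It is symmetric in \<open>x\<close> and \<open>y\<close>, so the
  Clifford relation, which gives twice the symmetric part, determines it.
\<close>

lemma cm_conformal: "cm x a \<bullet> cm y a = (x \<bullet> y) * (a \<bullet> a)"
  using arg_cong[OF cp_cm[of x y a], of "inner a"] skew[of x a "cm y a"] skew[of y a "cm x a"]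
  by (simp add: inner_add_right inner_commute)

lemma cp_conformal: "cp x b \<bullet> cp y b = (x \<bullet> y) * (b \<bullet> b)"
  using arg_cong[OF cm_cp[of x y b], of "inner b"] skew[of x "cp y b" b] skew[of y "cp x b" b]
  by (simp add: inner_add_right inner_commute)

lemma inj_cm: "a \<noteq> 0 \<Longrightarrow> inj (\<lambda>y. cm y a)"
  unfolding linear_injective_0[OF linear_cm(1)]
  using cm_conformal[of _ a] by (metis inner_eq_zero_iff inner_zero_left mult_eq_0_iff)

lemma inj_cp: "b \<noteq> 0 \<Longrightarrow> inj (\<lambda>y. cp y b)"
  unfolding linear_injective_0[OF linear_cp(1)]
  using cp_conformal[of _ b] by (metis inner_eq_zero_iff inner_zero_left mult_eq_0_iff)

lemma cm_onto:
  assumes "a \<noteq> 0" obtains y where "cm y a = b"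
proof -
  note inj_cm[OF assms]
  then have "surj (\<lambda>y. cm y a)"
    using dims by (intro linear_injective_imp_surjective linear_cm) auto
  then show ?thesis using that by (metis surjD)
qed

lemma cp_onto:
  assumes "b \<noteq> 0" obtains y where "cp y b = a"
proof -
  note inj_cp[OF assms]
  then have "surj (\<lambda>y. cp y b)"
    using dims by (intro linear_injective_imp_surjective linear_cp) auto
  then show ?thesis using that by (metis surjD)
qed

abbreviation S where "S \<equiv> spin_prod cm"

lemma inner_S: "x \<bullet> S a b = cm x a \<bullet> b"
proof -
  let ?v = "adjoint (\<lambda>x. cm x a) b"
  have v: "\<forall>x. x \<bullet> ?v = cm x a \<bullet> b"
    by (simp add: adjoint_works[OF linear_cm(1)])
  then have "S a b = ?v"
    unfolding spin_prod_def by (intro the_equality) (metis vector_eq_ldot)+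
  with v show ?thesis by simp
qed

lemma S_eqI: "(\<And>x. x \<bullet> v = cm x a \<bullet> b) \<Longrightarrow> S a b = v"
  by (metis vector_eq_ldot inner_S)

lemma bilinear_S: "bilinear S"
  unfolding bilinear_def
  by (intro conjI allI linearI S_eqI)
    (simp_all add: inner_add_right inner_add_left inner_S cm_simps)

lemmas S_simps = bilinear_ladd[OF bilinear_S] bilinear_radd[OF bilinear_S]
  bilinear_lmul[OF bilinear_S] bilinear_rmul[OF bilinear_S]
  bilinear_lzero[OF bilinear_S] bilinear_rzero[OF bilinear_S]

lemma S_cm: "S a (cm y a) = (a \<bullet> a) *\<^sub>R y"
  by (intro S_eqI) (simp add: cm_conformal)

lemma S_cp: "S (cp y b) b = - (b \<bullet> b) *\<^sub>R y"
  by (intro S_eqI) (simp add: skew cp_conformal, simp add: inner_commute)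

lemma S_conformal_right: "S a b \<bullet> S a b' = (a \<bullet> a) * (b \<bullet> b')"
proof (cases "a = 0")
  case False
  then obtain y where "cm y a = b" by (rule cm_onto)
  then show ?thesis using inner_S[of y a b'] by (auto simp: S_cm)
qed (simp add: S_simps)

lemma S_conformal_left: "S a b \<bullet> S a' b = (b \<bullet> b) * (a \<bullet> a')"
proof (cases "b = 0")
  case False
  then obtain y where y: "cp y b = a" by (rule cp_onto)
  then have "S a b = - (b \<bullet> b) *\<^sub>R y" using S_cp by blast
  then show ?thesis using inner_S[of y a' b] skew[of y a' b] y by (simp add: inner_commute[of a a'])
qed (simp add: S_simps)

text \<open>
  Polarization of \<open>S_conformal_right\<close> in its first argument. It expresses the product of the two
  mixed vectors in the expansion of the determinant through the product of the unmixed ones.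
\<close>

lemma S_exchange: "S a b \<bullet> S a' b' + S a' b \<bullet> S a b' = 2 * (a \<bullet> a') * (b \<bullet> b')"
  using S_conformal_right[of "a + a'" b b'] S_conformal_right[of a b b'] S_conformal_right[of a' b b']
  by (simp add: S_simps inner_add_left inner_add_right inner_commute algebra_simps)


section \<open>Symmetries\<close>

lemma det_eq: "spin_det cm ((a, b), (c, d)) =
    (a \<bullet> a) * (d \<bullet> d) + (c \<bullet> c) * (b \<bullet> b) - 2 * (S a b \<bullet> S c d)"
  by (simp add: spin_det_def dot_square_norm)

text \<open>
  The shear adds \<open>|a|\<^sup>2 x\<close> to \<open>S a b\<close> and \<open>|c|\<^sup>2 x\<close> to \<open>S c d\<close>. The terms linear and quadratic in
  \<open>x\<close> that this produces cancel those from the squared lengths.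
\<close>

lemma det_lower: "spin_det cm ((a, b + cm x a), (c, d + cm x c)) = spin_det cm ((a, b), (c, d))"
  using inner_S[of x a b] inner_S[of x c d]
  by (simp add: det_eq S_simps S_cm inner_add_left inner_add_right cm_conformal inner_commute
      algebra_simps)

lemma det_upper: "spin_det cm ((a + cp x b, b), (c + cp x d, d)) = spin_det cm ((a, b), (c, d))"
  using inner_S[of x a b] inner_S[of x c d] skew[of x a b] skew[of x c d]
  by (simp add: det_eq S_simps S_cp inner_add_left inner_add_right inner_diff_left inner_diff_right
      cp_conformal inner_commute algebra_simps)

text \<open>
  By the conformality identities, all inner products of the four vectors \<open>S\<close> formed from the
  entries are polynomials in the six inner products of entries and in \<open>z = S a b \<bullet> S c d\<close>, so the
  claim becomes a polynomial identity.
\<close>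

lemma det_rows:
  fixes \<alpha> \<beta> \<gamma> \<delta> :: real
  shows "spin_det cm (\<alpha> *\<^sub>R \<psi> + \<beta> *\<^sub>R \<omega>, \<gamma> *\<^sub>R \<psi> + \<delta> *\<^sub>R \<omega>) = (\<alpha> * \<delta> - \<beta> * \<gamma>)\<^sup>2 * spin_det cm (\<psi>, \<omega>)"
proof -
  obtain a b c d where \<psi>\<omega>: "\<psi> = (a, b)" "\<omega> = (c, d)" by fastforce
  define aa ac cc bb bd dd z where sc: "aa = a \<bullet> a" "ac = a \<bullet> c" "cc = c \<bullet> c"
    "bb = b \<bullet> b" "bd = b \<bullet> d" "dd = d \<bullet> d" "z = S a b \<bullet> S c d"
  have S: "S (x *\<^sub>R a + y *\<^sub>R c) (x *\<^sub>R b + y *\<^sub>R d) =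
      x\<^sup>2 *\<^sub>R S a b + (x * y) *\<^sub>R (S a d + S c b) + y\<^sup>2 *\<^sub>R S c d" for x y
    by (simp add: S_simps power2_eq_square algebra_simps)
  have c: "c \<bullet> a = ac" "d \<bullet> b = bd" "S a b \<bullet> S a b = aa * bb" "S c d \<bullet> S c d = cc * dd" "S a b \<bullet> S c d = z" "S c d \<bullet> S a b = z"
    "S a b \<bullet> S a d = aa * bd" "S a d \<bullet> S a b = aa * bd" "S a b \<bullet> S c b = bb * ac" "S c b \<bullet> S a b = bb * ac"
    "S c d \<bullet> S a d = dd * ac" "S a d \<bullet> S c d = dd * ac" "S c d \<bullet> S c b = cc * bd" "S c b \<bullet> S c d = cc * bd"
    "S a d \<bullet> S a d = aa * dd" "S c b \<bullet> S c b = cc * bb"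
    "S c b \<bullet> S a d = 2 * ac * bd - z" "S a d \<bullet> S c b = 2 * ac * bd - z"
    using S_exchange[of a b c d]
    by (simp_all add: sc S_conformal_right S_conformal_left inner_commute)
  show ?thesis
    unfolding \<psi>\<omega> scaleR_Pair add_Pair det_eq S inner_add_left inner_add_right
      inner_scaleR_left inner_scaleR_right c sc[symmetric]
    by algebra
qed

lemma spin91_symmetry:
  assumes "g \<in> spin91 cm cp"
  shows "linear g \<and> inj g \<and> (\<forall>\<psi> \<omega>. spin_det cm (g \<psi>, g \<omega>) = spin_det cm (\<psi>, \<omega>))"
  using assms
proof induction
  case one
  show ?case by (simp add: linear_id linear_ident)
next
  case (lower g x)
  define f where "f = (\<lambda>(a, b). (a, b + cm x a))"
  have "linear f" unfolding f_def by (rule linearI) (auto simp: cm_simps algebra_simps)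
  moreover have "inj f" by (auto simp: f_def inj_def)
  moreover have "spin_det cm (f \<psi>, f \<omega>) = spin_det cm (\<psi>, \<omega>)" for \<psi> \<omega>
    by (cases \<psi>; cases \<omega>) (simp add: f_def det_lower)
  ultimately show ?case
    unfolding f_def[symmetric] using lower.IH linear_compose[of g f] inj_compose[of f g]
    by (simp add: o_def)
next
  case (upper g x)
  define f where "f = (\<lambda>(a, b). (a + cp x b, b))"
  have "linear f" unfolding f_def by (rule linearI) (auto simp: cp_simps algebra_simps)
  moreover have "inj f" by (auto simp: f_def inj_def)
  moreover have "spin_det cm (f \<psi>, f \<omega>) = spin_det cm (\<psi>, \<omega>)" for \<psi> \<omega>
    by (cases \<psi>; cases \<omega>) (simp add: f_def det_upper)
  ultimately show ?case
    unfolding f_def[symmetric] using upper.IH linear_compose[of g f] inj_compose[of f g]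
    by (simp add: o_def)
qed

lemma group_symmetry:
  assumes g: "g \<in> spin91 cm cp" and M: "det M = 1"
  shows "linear (group_act g M)" "inj (group_act g M)"
    "spin_det cm (group_act g M \<sigma>) = spin_det cm \<sigma>"
proof -
  have lin: "linear g" and inj: "inj g"
    and D: "\<And>\<psi> \<omega>. spin_det cm (g \<psi>, g \<omega>) = spin_det cm (\<psi>, \<omega>)"
    using spin91_symmetry[OF g] by auto
  show lin': "linear (group_act g M)"
    by (rule linearI)
      (simp_all add: group_act_def split_beta linear_add[OF lin] linear_scale[OF lin] algebra_simps)
  have M': "M $ 1 $ 1 * M $ 2 $ 2 - M $ 1 $ 2 * M $ 2 $ 1 = 1"
    using M by (simp add: det_2)
  show "spin_det cm (group_act g M \<sigma>) = spin_det cm \<sigma>"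
    by (cases \<sigma>) (simp add: group_act_def det_rows M' D)
  show "inj (group_act g M)"
    unfolding linear_injective_0[OF lin']
  proof (intro allI impI)
    fix \<sigma> assume 0: "group_act g M \<sigma> = 0"
    obtain \<psi> \<omega> where \<sigma>: "\<sigma> = (\<psi>, \<omega>)" by (cases \<sigma>)
    let ?r = "M $ 1 $ 1 *\<^sub>R g \<psi> + M $ 1 $ 2 *\<^sub>R g \<omega>" and ?s = "M $ 2 $ 1 *\<^sub>R g \<psi> + M $ 2 $ 2 *\<^sub>R g \<omega>"
    have r: "?r = 0" "?s = 0" using 0 by (auto simp: group_act_def \<sigma> zero_prod_def)
    have "g \<psi> = (M $ 1 $ 1 * M $ 2 $ 2 - M $ 1 $ 2 * M $ 2 $ 1) *\<^sub>R g \<psi>" by (simp add: M')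
    also have "\<dots> = M $ 2 $ 2 *\<^sub>R ?r - M $ 1 $ 2 *\<^sub>R ?s" by (simp add: algebra_simps)
    finally have 1: "g \<psi> = 0" using r by simp
    have "g \<omega> = (M $ 1 $ 1 * M $ 2 $ 2 - M $ 1 $ 2 * M $ 2 $ 1) *\<^sub>R g \<omega>" by (simp add: M')
    also have "\<dots> = M $ 1 $ 1 *\<^sub>R ?s - M $ 2 $ 1 *\<^sub>R ?r" by (simp add: algebra_simps)
    finally have 2: "g \<omega> = 0" using r by simp
    from inj have "\<psi> = 0" "\<omega> = 0"
      using 1 2 linear_injective_0[OF lin] by blast+
    then show "\<sigma> = 0" by (simp add: \<sigma> zero_prod_def)
  qed
qed

text \<open>
  A lower shear makes the second entry of the first row zero. The determinant is then a product of
  squared lengths, so the new lower right entry is not zero, and an upper shear clears the lower left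
  entry; that shear fixes the first row, whose \<open>S\<^sup>+\<close> part is now zero.
\<close>

lemma diagonalize:
  assumes D: "spin_det cm ((a, b), (c, d)) = 1" and a: "a \<noteq> 0"
  obtains g s u v where "g \<in> spin91 cm cp" "s \<noteq> 0" "norm u = 1" "norm v = 1"
    "(a, b) = s *\<^sub>R g (u, 0)" "(c, d) = (1 / s) *\<^sub>R g (0, v)"
proof -
  obtain x where x: "cm x a = b" using a by (rule cm_onto)
  define d' where "d' = d - cm x c"
  have "spin_det cm ((a, 0), (c, d')) = 1"
    using det_lower[of a 0 x c d'] D by (simp add: d'_def x)
  then have nd: "(norm a * norm d')\<^sup>2 = 1"
    by (simp add: det_eq S_simps dot_square_norm power_mult_distrib)
  then have nd: "norm a * norm d' = 1"
    using power2_eq_imp_eq[of "norm a * norm d'" 1] by simp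
  then have "d' \<noteq> 0" by auto
  then obtain y where y: "cp y d' = c" by (rule cp_onto)
  \<comment> \<open>The inverse of the two clearing shears: they undo \<open>x\<close> and \<open>y\<close> in the opposite order.\<close>
  define g where "g = (\<lambda>(\<phi>m, \<phi>p). (\<phi>m, \<phi>p + cm x \<phi>m)) \<circ> ((\<lambda>(\<phi>m, \<phi>p). (\<phi>m + cp y \<phi>p, \<phi>p)) \<circ> id)"
  have "g \<in> spin91 cm cp"
    unfolding g_def by (intro spin91.intros)
  moreover have "(a, b) = norm a *\<^sub>R g ((1 / norm a) *\<^sub>R a, 0)"
    using a by (simp add: g_def cm_simps cp_simps x)
  moreover have "(c, d) = (1 / norm a) *\<^sub>R g (0, norm a *\<^sub>R d')"
    using a by (simp add: g_def cm_simps cp_simps y) (simp add: d'_def scaleR_add_right)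
  moreover have "norm ((1 / norm a) *\<^sub>R a) = 1" "norm (norm a *\<^sub>R d') = 1"
    using a nd by auto
  ultimately show ?thesis
    using that a by (metis norm_eq_zero)
qed

text \<open>
  If the upper left entry vanishes, the lower left one does not, since otherwise the determinant would
  be zero; the rotation of the plane by a right angle then reduces to the generic case.
\<close>

lemma transitive_on_SL2O:
  assumes D: "spin_det cm \<rho> = 1"
  obtains g M u v where "g \<in> spin91 cm cp" "det M = 1" "norm u = 1" "norm v = 1"
    "group_act g M ((u, 0), (0, v)) = \<rho>"
proof -
  obtain a b c d where \<rho>: "\<rho> = ((a, b), (c, d))" by (metis surj_pair)
  show ?thesis
  proof (cases "a = 0")
    case False
    with D obtain g s u v where *: "g \<in> spin91 cm cp" "s \<noteq> 0" "norm u = 1" "norm v = 1"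
      "(a, b) = s *\<^sub>R g (u, 0)" "(c, d) = (1 / s) *\<^sub>R g (0, v)"
      unfolding \<rho> by (rule diagonalize)
    show ?thesis
      using * by (intro that[of g "vector [vector [s, 0], vector [0, 1 / s]]" u v])
        (auto simp: det_2 group_act_def \<rho>)
  next
    case True
    have D': "spin_det cm ((c, d), (- a, - b)) = 1"
      using det_rows[of 0 "(a, b)" 1 "(c, d)" "-1" 0] D by (simp add: \<rho>)
    have "c \<noteq> 0" using D True by (auto simp: \<rho> det_eq S_simps)
    with D' obtain g s u v where *: "g \<in> spin91 cm cp" "s \<noteq> 0" "norm u = 1" "norm v = 1"
      "(c, d) = s *\<^sub>R g (u, 0)" "(- a, - b) = (1 / s) *\<^sub>R g (0, v)"
      by (rule diagonalize)
    have "(a, b) = - ((1 / s) *\<^sub>R g (0, v))" using *(6) by (metis uminus_Pair minus_minus)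
    then show ?thesis
      using * by (intro that[of g "vector [vector [0, - 1 / s], vector [s, 0]]" u v])
        (auto simp: det_2 group_act_def \<rho>)
  qed
qed


section \<open>Derivatives\<close>

definition det_deriv :: "('m, 'p) spin_matrix \<Rightarrow> ('m, 'p) spin_matrix \<Rightarrow> real" where
  "det_deriv = (\<lambda>((a, b), (c, d)) ((a', b'), (c', d')).
     2 * (a \<bullet> a') * (d \<bullet> d) + 2 * (a \<bullet> a) * (d \<bullet> d') + 2 * (c \<bullet> c') * (b \<bullet> b) + 2 * (c \<bullet> c) * (b \<bullet> b')
     - 2 * ((S a' b + S a b') \<bullet> S c d + S a b \<bullet> (S c' d + S c d')))"

definition det_deriv2 :: "('m, 'p) spin_matrix \<Rightarrow> ('m, 'p) spin_matrix \<Rightarrow> ('m, 'p) spin_matrix \<Rightarrow> real" where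
  "det_deriv2 = (\<lambda>((a, b), (c, d)) ((a'', b''), (c'', d'')) ((a', b'), (c', d')).
     2 * (a'' \<bullet> a') * (d \<bullet> d) + 4 * (a \<bullet> a') * (d \<bullet> d'') + 4 * (a \<bullet> a'') * (d \<bullet> d') + 2 * (a \<bullet> a) * (d'' \<bullet> d')
     + 2 * (c'' \<bullet> c') * (b \<bullet> b) + 4 * (c \<bullet> c') * (b \<bullet> b'') + 4 * (c \<bullet> c'') * (b \<bullet> b') + 2 * (c \<bullet> c) * (b'' \<bullet> b')
     - 2 * ((S a' b'' + S a'' b') \<bullet> S c d + (S a' b + S a b') \<bullet> (S c'' d + S c d'')
        + (S a'' b + S a b'') \<bullet> (S c' d + S c d') + S a b \<bullet> (S c' d'' + S c'' d')))"

lemma has_derivative_S: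
  assumes "(f has_derivative f') (at x within A)" "(g has_derivative g') (at x within A)"
  shows "((\<lambda>x. S (f x) (g x)) has_derivative (\<lambda>h. S (f x) (g' h) + S (f' h) (g x))) (at x within A)"
  using bounded_bilinear.FDERIV[OF bilinear_conv_bounded_bilinear[THEN iffD1, OF bilinear_S] assms] .

lemma has_derivative_det: "(spin_det cm has_derivative det_deriv \<sigma>) (at \<sigma>)"
proof -
  have *: "spin_det cm = (\<lambda>\<sigma>. (fst (fst \<sigma>) \<bullet> fst (fst \<sigma>)) * (snd (snd \<sigma>) \<bullet> snd (snd \<sigma>)) +
     (fst (snd \<sigma>) \<bullet> fst (snd \<sigma>)) * (snd (fst \<sigma>) \<bullet> snd (fst \<sigma>))
      - 2 * (S (fst (fst \<sigma>)) (snd (fst \<sigma>)) \<bullet> S (fst (snd \<sigma>)) (snd (snd \<sigma>))))"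
    by (auto simp: det_eq)
  show ?thesis
    unfolding * det_deriv_def split_beta
    by (rule derivative_eq_intros has_derivative_S refl ext)+
      (simp add: inner_commute algebra_simps)
qed

lemma has_derivative_det_deriv: "((\<lambda>\<sigma>. det_deriv \<sigma> Y) has_derivative (\<lambda>X. det_deriv2 \<sigma> X Y)) (at \<sigma>)"
  unfolding det_deriv_def det_deriv2_def split_beta
  by (rule derivative_eq_intros has_derivative_S refl ext)+
    (simp add: inner_commute S_simps inner_add_left inner_add_right algebra_simps)

lemma invariant_inner_eq:
  assumes "spin_det cm \<rho> = 1"
  shows "invariant_inner cm \<rho> X Y = det_deriv2 \<rho> X Y - det_deriv \<rho> X * det_deriv \<rho> Y"
  unfolding invariant_inner_def
  using hessian_ln[OF has_derivative_det has_derivative_det_deriv, of \<rho> X Y] assms by simp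

lemma tangent_space_SL2O:
  assumes "spin_det cm \<rho> = 1"
  shows "tangent_space (SL2O cm) \<rho> = {X. det_deriv \<rho> X = 0}"
  unfolding SL2O_def
proof (rule tangent_space_homogeneous_level[OF has_derivative_det _ _ assms])
  show "spin_det cm (t *\<^sub>R \<sigma>) = t ^ 4 * spin_det cm \<sigma>" for t \<sigma>
    using det_rows[of t "fst \<sigma>" 0 "snd \<sigma>" 0 t] by (cases \<sigma>)
      (simp add: power2_eq_square power4_eq_xxxx mult.assoc flip: zero_prod_def)
qed simp

text \<open>
  Uniqueness of derivatives, applied to both sides of \<open>D \<circ> G = D\<close> and then once more to the
  resulting identity of first derivatives.
\<close>

lemma derivative_symmetry:
  assumes G: "linear G" and D: "\<And>\<sigma>. spin_det cm (G \<sigma>) = spin_det cm \<sigma>"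
  shows "det_deriv (G \<sigma>) (G X) = det_deriv \<sigma> X" "det_deriv2 (G \<sigma>) (G X) (G Y) = det_deriv2 \<sigma> X Y"
proof -
  have G': "(G has_derivative G) (at \<sigma>)" for \<sigma>
    using G by (rule linear_imp_has_derivative)
  have 1: "det_deriv (G \<sigma>) (G X) = det_deriv \<sigma> X" for \<sigma> X
    using has_derivative_unique[OF has_derivative_compose[OF G' has_derivative_det], unfolded D,
      OF has_derivative_det] by metis
  show "det_deriv (G \<sigma>) (G X) = det_deriv \<sigma> X" by (rule 1)
  show "det_deriv2 (G \<sigma>) (G X) (G Y) = det_deriv2 \<sigma> X Y"
    using has_derivative_unique[OF has_derivative_compose[OF G' has_derivative_det_deriv[of "G Y"]],
        unfolded 1, OF has_derivative_det_deriv] by metis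
qed


section \<open>The form at a diagonal matrix\<close>

context
  fixes u :: 'm and v :: 'p
  assumes unit: "norm u = 1" "norm v = 1"
begin

lemma uv: "u \<bullet> u = 1" "v \<bullet> v = 1" "u \<noteq> 0" "v \<noteq> 0"
  using unit by (auto simp: dot_square_norm)

abbreviation \<rho>0 where "\<rho>0 \<equiv> ((u, 0), (0, v))"

lemma det_\<rho>0: "spin_det cm \<rho>0 = 1"
  by (simp add: det_eq S_simps uv)

lemma det_deriv_\<rho>0: "det_deriv \<rho>0 ((a, b), (c, d)) = 2 * (u \<bullet> a + v \<bullet> d)"
  by (simp add: det_deriv_def S_simps uv)

lemma det_deriv2_\<rho>0:
  "det_deriv2 \<rho>0 ((a, b), (c, d)) ((a', b'), (c', d')) =
     2 * (a \<bullet> a') + 2 * (d \<bullet> d') + 4 * (u \<bullet> a') * (v \<bullet> d) + 4 * (u \<bullet> a) * (v \<bullet> d')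
     - 2 * (S u b' \<bullet> S c v + S u b \<bullet> S c' v)"
  by (simp add: det_deriv2_def S_simps uv)

text \<open>
  In these coordinates \<open>S u (y \<cdot> u) = y\<close> and \<open>S (w \<cdot> v) v = - w\<close>, so the off-diagonal part becomes the
  standard hyperbolic form on two copies of the Euclidean space.
\<close>

lemma form_\<rho>0:
  assumes "u \<bullet> a + v \<bullet> d = 0" "u \<bullet> a' + v \<bullet> d' = 0"
  shows "invariant_inner cm \<rho>0 ((a, cm y u), (cp w v, d)) ((a', cm y' u), (cp w' v, d')) =
     2 * (a \<bullet> a') + 2 * (d \<bullet> d') - 8 * (u \<bullet> a) * (u \<bullet> a') + 2 * (y' \<bullet> w + y \<bullet> w')"
proof -
  have "v \<bullet> d = - (u \<bullet> a)" "v \<bullet> d' = - (u \<bullet> a')" using assms by simp_all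
  then show ?thesis
    by (simp add: invariant_inner_eq det_\<rho>0 det_deriv_\<rho>0 det_deriv2_\<rho>0 S_cm S_cp uv)
qed

text \<open>
  The positive subspace takes \<open>w = y\<close> and the diagonal entries orthogonal to \<open>u\<close> and \<open>v\<close>; the
  negative one takes \<open>w = - y\<close> and the diagonal line \<open>(k u, - k v)\<close>.
\<close>

lemma signature_\<rho>0:
  "has_signature (tangent_space (SL2O cm) \<rho>0) (invariant_inner cm \<rho>0) 22 9"
proof -
  let ?B = "invariant_inner cm \<rho>0"
  define f where "f = (\<lambda>((a :: 'm, d :: 'p), y). ((a, cm y u), (cp y v, d)))"
  define g where "g = (\<lambda>(k, y). ((k *\<^sub>R u, cm y u), (cp (- y) v, - k *\<^sub>R v)))"
  define H where "H = ({a. u \<bullet> a = 0} \<times> {d. v \<bullet> d = 0}) \<times> (UNIV :: (real^8) set)"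
  have f: "linear f" unfolding f_def by (rule linearI) (auto simp: cm_simps cp_simps)
  have g: "linear g" unfolding g_def by (rule linearI) (auto simp: cm_simps cp_simps algebra_simps)
  have injf: "inj f"
    using inj_cm[OF uv(3)] by (auto simp: f_def inj_def)
  have injg: "inj g"
    using inj_cm[OF uv(3)] uv by (auto simp: g_def inj_def)
  have H: "subspace H" unfolding H_def
    by (intro subspace_Times subspace_hyperplane subspace_UNIV)
  have "dim H = 22"
    unfolding H_def using uv dims
    by (simp add: dim_Times subspace_Times subspace_hyperplane dim_hyperplane)
  then have dimf: "dim (f ` H) = 22"
    using dim_image_eq[OF f, of H] injf by (metis inj_on_subset subset_UNIV)
  have dimg: "dim (range g) = 9"
    using dim_image_eq[OF g, of UNIV] injg by simp
  have V: "tangent_space (SL2O cm) \<rho>0 = {X. det_deriv \<rho>0 X = 0}"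
    by (rule tangent_space_SL2O[OF det_\<rho>0])
  have "{X. det_deriv \<rho>0 X = 0} = {x + z |x z. x \<in> f ` H \<and> z \<in> range g}"
  proof (intro set_eqI iffI)
    fix X assume "X \<in> {X. det_deriv \<rho>0 X = 0}"
    moreover obtain a b c d where X: "X = ((a, b), (c, d))" by (metis surj_pair)
    ultimately have tr: "u \<bullet> a + v \<bullet> d = 0" by (simp add: det_deriv_\<rho>0)
    obtain y where y: "cm y u = b" using uv by (auto intro: cm_onto)
    obtain w where w: "cp w v = c" using uv by (auto intro: cp_onto)
    let ?x = "((a - (u \<bullet> a) *\<^sub>R u, d + (u \<bullet> a) *\<^sub>R v), (1/2) *\<^sub>R (y + w))"
    let ?z = "(u \<bullet> a, (1/2) *\<^sub>R (y - w))"
    have "?x \<in> H" using tr by (simp add: H_def inner_diff_right inner_add_right uv)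
    moreover have "(1/2) *\<^sub>R (y + w) + (1/2) *\<^sub>R (y - w) = y" "(1/2) *\<^sub>R (y + w) + - ((1/2) *\<^sub>R (y - w)) = w"
      by (simp_all add: vec_eq_iff field_simps)
    then have "X = f ?x + g ?z"
      unfolding X f_def g_def prod.case add_Pair linear_cm(1)[THEN linear_add, symmetric]
        linear_cp(1)[THEN linear_add, symmetric] by (simp add: y w)
    ultimately show "X \<in> {x + z |x z. x \<in> f ` H \<and> z \<in> range g}" by blast
  qed (auto simp: f_def g_def H_def det_deriv_\<rho>0 inner_add_right inner_diff_right uv)
  moreover have "?B (f x) (f x) > 0" if "x \<in> H" "f x \<noteq> 0" for x
  proof -
    obtain a d y where x: "x = ((a, d), y)" by (metis surj_pair)
    have "x \<noteq> 0" using that linear_0[OF f] by auto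
    then have "a \<bullet> a > 0 \<or> d \<bullet> d > 0 \<or> y \<bullet> y > 0" by (auto simp: x zero_prod_def)
    moreover have "?B (f x) (f x) = 2 * (a \<bullet> a) + 2 * (d \<bullet> d) + 4 * (y \<bullet> y)"
      using that(1) by (simp add: x f_def H_def form_\<rho>0)
    ultimately show ?thesis
      using inner_ge_zero[of a] inner_ge_zero[of d] inner_ge_zero[of y] by linarith
  qed
  moreover have "?B (g x) (g x) < 0" if "g x \<noteq> 0" for x
  proof -
    obtain k y where x: "x = (k, y)" by (metis surj_pair)
    have "x \<noteq> 0" using that linear_0[OF g] by auto
    then have "k * k > 0 \<or> y \<bullet> y > 0" by (auto simp: x zero_prod_def zero_less_mult_iff)
    moreover have "?B (g x) (g x) = - 4 * (k * k) - 4 * (y \<bullet> y)"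
      by (simp add: x g_def form_\<rho>0 uv)
    ultimately show ?thesis
      using zero_le_square[of k] inner_ge_zero[of y] by linarith
  qed
  moreover have "?B (f x) (g z) = 0 \<and> ?B (g z) (f x) = 0" if "x \<in> H" for x z
    using that by (cases x; cases "fst x"; cases z)
      (simp add: f_def g_def H_def form_\<rho>0 uv inner_commute)
  ultimately show ?thesis
    unfolding has_signature_def V
    using linear_subspace_image[OF f H] linear_subspace_image[OF g subspace_UNIV] dimf dimg
    by (intro exI[of _ "f ` H"] exI[of _ "range g"]) auto
qed

text \<open>
  The unit vector \<open>S u v\<close> takes \<open>u\<close> to \<open>v\<close> and multiplies isometrically, so every inner product in
  \<open>S\<^sup>+\<close> moves to \<open>S\<^sup>-\<close>; the exchange identity handles the remaining off-diagonal term. The formula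
  is written symmetrically in \<open>a\<close> and \<open>d\<close>, using that their components along \<open>u\<close> are opposite.
\<close>

lemma form_in_S_minus_coordinates:
  assumes tr: "u \<bullet> a + v \<bullet> cm (S u v) d = 0"
  shows "invariant_inner cm \<rho>0 ((a, cm (S u v) b), (c, cm (S u v) d)) ((a, cm (S u v) b), (c, cm (S u v) d)) =
    2 * (a \<bullet> a) - 4 * (u \<bullet> a)\<^sup>2 + 2 * (d \<bullet> d) - 4 * (u \<bullet> d)\<^sup>2 + 4 * (b \<bullet> c) - 8 * (u \<bullet> b) * (u \<bullet> c)"
proof -
  let ?e = "S u v"
  obtain x where x: "cm x u = v" using uv by (auto intro: cm_onto)
  then have eu: "cm ?e u = v" using S_cm[of u x] by (simp add: uv)
  have e: "?e \<bullet> ?e = 1" by (simp add: S_conformal_right uv)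
  have iso: "cm ?e p \<bullet> cm ?e q = p \<bullet> q" for p q
    using cp_cm[of ?e ?e q] skew[of ?e p "cm ?e q"]
    by (simp add: e flip: scaleR_2) (simp flip: scaleR_minus_right)
  have vd: "v \<bullet> cm ?e q = u \<bullet> q" for q using iso[of u q] by (simp add: eu)
  have "S u (cm ?e b) \<bullet> S c v + S c (cm ?e b) \<bullet> ?e = 2 * (u \<bullet> c) * (u \<bullet> b)"
    using S_exchange[of u "cm ?e b" c v] by (simp add: vd inner_commute[of _ v])
  moreover have "S c (cm ?e b) \<bullet> ?e = b \<bullet> c"
    using inner_S[of ?e c "cm ?e b"] by (simp add: iso inner_commute)
  ultimately have cross: "S u (cm ?e b) \<bullet> S c v = 2 * (u \<bullet> c) * (u \<bullet> b) - b \<bullet> c" by simp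
  have "u \<bullet> d = - (u \<bullet> a)" using tr by (simp add: vd)
  then show ?thesis
    using tr by (simp add: invariant_inner_eq det_\<rho>0 det_deriv_\<rho>0 det_deriv2_\<rho>0 cross iso vd power2_eq_square)
qed

end

end


section \<open>The formula in octonionic coordinates\<close>

text \<open>
  Together with \<open>oone\<close>, a standard basis is orthonormal in the octonions, so the real matrices are
  the coordinates of the entries.
\<close>

lemma octonion_matrix_inner:
  assumes e: "standard_imag_basis e"
  shows "octonion_matrix e A $ r $ s \<bullet> oone = A 0 $ r $ s"
    and "octonion_matrix e A $ r $ s \<bullet> octonion_matrix e A $ k $ l =
      A 0 $ r $ s * A 0 $ k $ l + (\<Sum>i\<in>{1..7}. A i $ r $ s * A i $ k $ l)"
proof -
  have o: "oone \<bullet> oone = 1" by (simp add: octonion_simps)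
  have eo: "e i \<bullet> oone = 0" "oone \<bullet> e i = 0" if "i \<in> {1..7}" for i
    using e that by (auto simp: standard_imag_basis_def inner_commute)
  have ee: "e i \<bullet> e j = (if i = j then 1 else 0)" if "i \<in> {1..7}" "j \<in> {1..7}" for i j
    using e that unfolding standard_imag_basis_def by blast
  show "octonion_matrix e A $ r $ s \<bullet> oone = A 0 $ r $ s"
    by (simp add: octonion_matrix_def inner_add_left inner_sum_left o eo)
  have "(\<Sum>i\<in>{1..7}. \<Sum>j\<in>{1..7}. A i $ k $ l * (A j $ r $ s * (e j \<bullet> e i))) =
      (\<Sum>i\<in>{1..7}. \<Sum>j\<in>{1..7}. if i = j then A j $ r $ s * A i $ k $ l else 0)"
    by (intro sum.cong refl) (simp add: ee)
  also have "\<dots> = (\<Sum>i\<in>{1..7}. A i $ r $ s * A i $ k $ l)"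
    by (intro sum.cong refl) (simp add: sum.delta)
  finally show "octonion_matrix e A $ r $ s \<bullet> octonion_matrix e A $ k $ l =
      A 0 $ r $ s * A 0 $ k $ l + (\<Sum>i\<in>{1..7}. A i $ r $ s * A i $ k $ l)"
    by (simp add: octonion_matrix_def inner_add_left inner_add_right inner_sum_left inner_sum_right
        sum_distrib_left o eo)
qed

lemma trace_square_2: "trace (M ** M) = (M $ 1 $ 1)\<^sup>2 + 2 * (M $ 1 $ 2 * M $ 2 $ 1) + (M $ 2 $ 2)\<^sup>2"
  for M :: "real^2^2"
  by (simp add: trace_def matrix_matrix_mult_def sum_2 power2_eq_square)

context half_spin
begin

text \<open>
  The form at the given point is pulled back to the base point by the group element in the
  representation, and the isometric identification turns its inner products into coordinates of the
  entries. The squares of the real parts of the diagonal entries enter with coefficient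
  \<open>2 - 4 = - 2\<close>, and the product of the real parts off the diagonal with \<open>4 - 8 = - 4\<close>, which is
  where the minus sign before the real matrix comes from.
\<close>

lemma form_octonionic:
  assumes e: "standard_imag_basis e" and \<rho>: "spin_det cm \<rho> = 1"
    and X: "X \<in> tangent_space (SL2O cm) \<rho>"
    and rep: "represents_tangent cm cp \<rho> X (octonion_matrix e A)"
  shows "invariant_inner cm \<rho> X X = 2 * ((\<Sum>i\<in>{1..7}. trace (A i ** A i)) - trace (A 0 ** A 0))"
proof -
  obtain u v \<iota> g M X0 where unit: "norm u = 1" "norm v = 1"
    and \<iota>: "octonion_identification cm cp u v \<iota>" and gM: "g \<in> spin91 cm cp" "det M = 1"
    and G: "group_act g M ((u, 0), (0, v)) = \<rho>" "group_act g M X0 = X"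
    and Q: "base_matrix cm u v \<iota> X0 = octonion_matrix e A"
    using rep unfolding represents_tangent_def by blast
  let ?\<rho> = "((u, 0), (0, v))"
  note sym = group_symmetry[OF gM]
  note tr = derivative_symmetry[OF sym(1) sym(3)]
  have form: "invariant_inner cm \<rho> X X = invariant_inner cm ?\<rho> X0 X0"
    using tr(1)[of ?\<rho> X0] tr(2)[of ?\<rho> X0 X0]
    by (simp add: G invariant_inner_eq \<rho> det_\<rho>0[OF unit])
  have tangent: "det_deriv ?\<rho> X0 = 0"
    using X tr(1)[of ?\<rho> X0] by (simp add: G tangent_space_SL2O[OF \<rho>])
  let ?e = "S u v"
  have "?e \<bullet> ?e = 1" by (simp add: S_conformal_right uv[OF unit])
  then have "cm ?e (- cp ?e b) = b" for b
    using cm_cp[of ?e ?e b] by (simp add: cm_simps flip: scaleR_2) (simp flip: scaleR_minus_right)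
  then have "surj (cm ?e)" by (rule surjI)
  then have inv: "cm ?e (inv (cm ?e) b) = b" for b by (rule surj_f_inv_f)
  obtain a B c D where X0: "X0 = ((a, B), (c, D))" by (metis surj_pair)
  define b d where bd: "b = inv (cm ?e) B" "d = inv (cm ?e) D"
  have BD: "B = cm ?e b" "D = cm ?e d" by (simp_all add: bd inv)
  have entries: "octonion_matrix e A $ 1 $ 1 = \<iota> a" "octonion_matrix e A $ 1 $ 2 = \<iota> b"
    "octonion_matrix e A $ 2 $ 1 = \<iota> c" "octonion_matrix e A $ 2 $ 2 = \<iota> d"
    by (simp_all add: Q[symmetric] base_matrix_def X0 bd)
  have lin: "linear \<iota>" and nrm: "norm (\<iota> x) = norm x" and one: "\<iota> u = oone" for x
    using \<iota> by (auto simp: octonion_identification_def)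
  have inner: "x \<bullet> y = \<iota> x \<bullet> \<iota> y" for x y
    by (simp add: dot_norm nrm flip: linear_add[OF lin])
  note coords = octonion_matrix_inner[OF e, of A, symmetric]
  have re: "u \<bullet> a = A 0 $ 1 $ 1" "u \<bullet> b = A 0 $ 1 $ 2" "u \<bullet> c = A 0 $ 2 $ 1" "u \<bullet> d = A 0 $ 2 $ 2"
    by (simp_all add: inner one coords(1) entries inner_commute)
  have pr: "a \<bullet> a = (A 0 $ 1 $ 1)\<^sup>2 + (\<Sum>i\<in>{1..7}. (A i $ 1 $ 1)\<^sup>2)"
    "d \<bullet> d = (A 0 $ 2 $ 2)\<^sup>2 + (\<Sum>i\<in>{1..7}. (A i $ 2 $ 2)\<^sup>2)"
    "b \<bullet> c = A 0 $ 1 $ 2 * A 0 $ 2 $ 1 + (\<Sum>i\<in>{1..7}. A i $ 1 $ 2 * A i $ 2 $ 1)"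
    unfolding inner entries[symmetric] power2_eq_square octonion_matrix_inner(2)[OF e] by simp_all
  have "u \<bullet> a + v \<bullet> cm ?e d = 0"
    using tangent by (simp add: X0 BD det_deriv_\<rho>0[OF unit])
  from form_in_S_minus_coordinates[OF unit this, of b c]
  have "invariant_inner cm ?\<rho> X0 X0 =
      2 * (a \<bullet> a) - 4 * (u \<bullet> a)\<^sup>2 + 2 * (d \<bullet> d) - 4 * (u \<bullet> d)\<^sup>2 + 4 * (b \<bullet> c) - 8 * (u \<bullet> b) * (u \<bullet> c)"
    by (simp add: X0 BD)
  then show ?thesis
    unfolding form re pr trace_square_2
    by (simp add: sum.distrib sum_distrib_left[symmetric] algebra_simps)
qed

lemma signature_SL2O:
  assumes \<rho>: "spin_det cm \<rho> = 1"
  shows "has_signature (tangent_space (SL2O cm) \<rho>) (invariant_inner cm \<rho>) 22 9"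
proof -
  obtain g M u v where gM: "g \<in> spin91 cm cp" "det M = 1" and unit: "norm u = 1" "norm v = 1"
    and G: "group_act g M ((u, 0), (0, v)) = \<rho>"
    using \<rho> by (rule transitive_on_SL2O)
  let ?\<rho> = "((u, 0), (0, v))" and ?G = "group_act g M"
  note sym = group_symmetry[OF gM]
  note tr = derivative_symmetry[OF sym(1) sym(3), of ?\<rho>, unfolded G]
  have surj: "surj ?G"
    using sym(1,2) by (rule linear_injective_imp_surjective) simp
  have "tangent_space (SL2O cm) \<rho> = ?G ` tangent_space (SL2O cm) ?\<rho>"
    unfolding tangent_space_SL2O[OF \<rho>] tangent_space_SL2O[OF det_\<rho>0[OF unit]]
    using surj_image_vimage_eq[OF surj, of "{Y. det_deriv \<rho> Y = 0}"] by (simp add: vimage_def tr(1))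
  moreover have "invariant_inner cm \<rho> (?G X) (?G Y) = invariant_inner cm ?\<rho> X Y" for X Y
    by (simp add: invariant_inner_eq \<rho> det_\<rho>0[OF unit] tr)
  ultimately show ?thesis
    using has_signature_image[OF signature_\<rho>0[OF unit] sym(1,2)] by simp
qed

end

theorem proposition4:
  fixes cm :: "real^8 \<Rightarrow> 'm::euclidean_space \<Rightarrow> 'p::euclidean_space"
    and cp :: "real^8 \<Rightarrow> 'p \<Rightarrow> 'm"
    and e :: "nat \<Rightarrow> octonion"
    and \<rho> :: "('m, 'p) spin_matrix"
  assumes "half_spin_clifford cm cp"
    and "standard_imag_basis e"
    and "\<rho> \<in> SL2O cm"
  shows "(\<forall>X \<in> tangent_space (SL2O cm) \<rho>. \<forall>A :: nat \<Rightarrow> real^2^2.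
            represents_tangent cm cp \<rho> X (octonion_matrix e A) \<longrightarrow>
            invariant_inner cm \<rho> X X =
              2 * ((\<Sum>i\<in>{1..7}. trace (A i ** A i)) - trace (A 0 ** A 0))) \<and>
         has_signature (tangent_space (SL2O cm) \<rho>) (invariant_inner cm \<rho>) 22 9"
proof -
  interpret half_spin cm cp by unfold_locales (rule assms(1))
  have "spin_det cm \<rho> = 1" using assms(3) by (simp add: SL2O_def)
  then show ?thesis
    using form_octonionic[OF assms(2)] signature_SL2O by blast
qed

end
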